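(* Let $\alpha\geq\aleph_{0}$ and $\beta\ge\alpha$ be cardinal numbers. The set $\mathcal{ND}[0,1]$ of all continuous nowhere differentiable functions $f\colon[0,1]\to\mathbb{R}$ is not $(\alpha,\beta)$-spaceable in $C[0,1]$.
   Context: $C[0,1]$ is the real Banach space of continuous functions $[0,1]\to\mathbb{R}$ with the supremum norm. Dimension means algebraic (Hamel) dimension. A subset $A$ of a vector space $V$ is $\alpha$-lineable if $A\cup\{0\}$ contains an $\alpha$-dimensional vector subspace of $V$. For cardinals $\alpha\le\beta$ and $V$ endowed with a topology, a non-void subset $A\subset V$ is $(\alpha,\beta)$-spaceable if it is $\alpha$-lineable and for each $\alpha$-dimensional subspace $W_\alpha\subset A\cup\{0\}$ there is a closed $\beta$-dimensional subspace $W_\beta$ of $V$ with $W_\alpha\subset W_\beta\subset A\cup\{0\}$. *)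

theory Defs
  imports "HOL-Analysis.Analysis"
begin

unbundle cardinal_syntax

(* Cardinal numbers are represented, as in the cardinal theory of Main, by well-orders r with
   Card_order r; natLeq is aleph_0. *)

definition has_hamel_dim :: "'a::real_vector set \<Rightarrow> 'i rel \<Rightarrow> bool" where
  "has_hamel_dim W \<alpha> \<longleftrightarrow> subspace W \<and> (\<exists>B. independent B \<and> span B = W \<and> |B| =o \<alpha>)"

definition lineable :: "'i rel \<Rightarrow> 'a::real_vector set \<Rightarrow> bool" where
  "lineable \<alpha> A \<longleftrightarrow> (\<exists>W. has_hamel_dim W \<alpha> \<and> W \<subseteq> A \<union> {0})"

definition spaceable ::
  "'i rel \<Rightarrow> 'j rel \<Rightarrow> 'a::{real_vector, topological_space} set \<Rightarrow> bool" where
  "spaceable \<alpha> \<beta> A \<longleftrightarrow> A \<noteq> {} \<and> lineable \<alpha> A \<and>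
     (\<forall>W. has_hamel_dim W \<alpha> \<and> W \<subseteq> A \<union> {0} \<longrightarrow>
       (\<exists>V. has_hamel_dim V \<beta> \<and> closed V \<and> W \<subseteq> V \<and> V \<subseteq> A \<union> {0}))"

(* The interval [0,1] as a metric space of its own, so that bounded continuous functions on it,
   with the supremum norm of the library, form C[0,1]. *)

typedef unit_interval = "{0..1::real}"
  by (rule exI[of _ 0]) simp

instantiation unit_interval :: metric_space
begin

definition dist_unit_interval :: "unit_interval \<Rightarrow> unit_interval \<Rightarrow> real" where
  "dist_unit_interval s t = dist (Rep_unit_interval s) (Rep_unit_interval t)"

definition uniformity_unit_interval :: "(unit_interval \<times> unit_interval) filter" where
  "uniformity_unit_interval = (INF e\<in>{0<..}. principal {(s, t). dist s t < e})"

definition open_unit_interval :: "unit_interval set \<Rightarrow> bool" where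
  "open_unit_interval U =
     (\<forall>s\<in>U. eventually (\<lambda>(s', t). s' = s \<longrightarrow> t \<in> U) uniformity)"

instance
proof
  fix s t u :: unit_interval
  show "dist s t = 0 \<longleftrightarrow> s = t"
    by (simp add: dist_unit_interval_def Rep_unit_interval_inject)
  show "dist s t \<le> dist s u + dist t u"
    by (simp add: dist_unit_interval_def dist_triangle2)
qed (simp_all add: uniformity_unit_interval_def open_unit_interval_def)

end

type_synonym C01 = "unit_interval \<Rightarrow>\<^sub>C real"

(* The values outside [0,1] are irrelevant wherever this function is used. *)
definition on_reals :: "C01 \<Rightarrow> real \<Rightarrow> real" where
  "on_reals f x = apply_bcontfun f (Abs_unit_interval x)"

(* Elements of C01 are exactly the continuous functions on [0,1]; boundedness is automatic. *)

lemma continuous_on_on_reals: "continuous_on {0..1} (on_reals f)"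
proof -
  have "continuous_on {0..1} Abs_unit_interval"
    unfolding continuous_on_iff dist_unit_interval_def
    by (auto simp: Abs_unit_interval_inverse)
  then show ?thesis
    unfolding on_reals_def
    by (rule continuous_on_compose2[of UNIV "apply_bcontfun f", rotated]) auto
qed

lemma C01_surj:
  fixes g :: "real \<Rightarrow> real"
  assumes "continuous_on {0..1} g"
  shows "\<exists>f :: C01. \<forall>x\<in>{0..1}. on_reals f x = g x"
proof -
  have "continuous_on UNIV Rep_unit_interval"
    unfolding continuous_on_iff dist_unit_interval_def by auto
  then have cont: "continuous_on UNIV (\<lambda>t. g (Rep_unit_interval t))"
    by (rule continuous_on_compose2[OF assms]) (use Rep_unit_interval in auto)
  have "bounded (g ` {0..1})"
    using assms by (intro compact_imp_bounded compact_continuous_image) auto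
  then obtain b where "\<And>x. x \<in> {0..1} \<Longrightarrow> norm (g x) \<le> b"
    unfolding bounded_iff by blast
  then have "(\<lambda>t. g (Rep_unit_interval t)) \<in> bcontfun"
    by (intro bcontfun_normI[OF cont]) (use Rep_unit_interval in auto)
  then show ?thesis
    by (intro exI[of _ "Bcontfun (\<lambda>t. g (Rep_unit_interval t))"])
       (auto simp: on_reals_def Bcontfun_inverse Abs_unit_interval_inverse)
qed

(* "within {0..1}" makes differentiability at the endpoints 0 and 1 one-sided. *)
definition ND :: "C01 set" where
  "ND = {f. \<forall>x\<in>{0..1}. \<not> on_reals f differentiable (at x within {0..1})}"

end

theory Submission
  imports Defs
begin

text \<open>
  Nowhere differentiability survives the addition of a constant, and a constant is not nowhere
  differentiable. If no \<open>\<alpha>\<close>-dimensional space of nowhere differentiable functions (and \<open>0\<close>) exists,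
  there is nothing to show. Otherwise take such a space \<open>W\<close> and tilt it in the direction of the
  constant \<open>u = 1\<close>: replace every \<open>w \<in> W\<close> by \<open>w + \<phi> w u\<close> for a linear functional \<open>\<phi>\<close>. For \<open>w \<noteq> 0\<close>
  this is again nowhere differentiable, in particular nonzero, so the tilted space is a linear copy
  of \<open>W\<close> of the same kind and the same dimension. As \<open>W\<close> is infinite-dimensional, \<open>\<phi>\<close> can be chosen
  unbounded: there are \<open>w \<in> W\<close> with \<open>\<phi> w = 1\<close> and \<open>w\<close> arbitrarily small, so that \<open>u\<close> is a limit of
  elements \<open>w + u\<close> of the tilted space. Every closed space above it then contains \<open>u\<close>, which is
  neither \<open>0\<close> nor nowhere differentiable.
  Lemma \<open>not_spaceable_if_translation_invariant\<close> is this argument for an arbitrary set invariant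
  under translations along a nonzero direction outside it.
\<close>

text \<open>
  Prescribing the values \<open>(n + 1) \<parallel>e n\<parallel>\<close> on a sequence \<open>e\<close> of distinct basis vectors makes \<open>\<phi>\<close>
  unbounded; rescaling \<open>e n\<close> by its value gives the null sequence.
\<close>

lemma infinite_independent_unbounded_functional:
  fixes B :: "'a::real_normed_vector set"
  assumes "independent B" and "infinite B"
  obtains \<phi> :: "'a \<Rightarrow> real" and x :: "nat \<Rightarrow> 'a"
  where "linear \<phi>" and "\<And>n. x n \<in> span B" and "\<And>n. \<phi> (x n) = 1" and "x \<longlonglongrightarrow> 0"
proof -
  obtain e :: "nat \<Rightarrow> 'a" where e: "inj e" "range e \<subseteq> B"
    using infinite_countable_subset[OF \<open>infinite B\<close>] by blast
  obtain \<phi> :: "'a \<Rightarrow> real" where lin: "linear \<phi>"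
    and \<phi>: "\<And>b. b \<in> B \<Longrightarrow> \<phi> b = (real (inv e b) + 1) * norm b"
    using linear_independent_extend
      [OF \<open>independent B\<close>, of "\<lambda>b. (real (inv e b) + 1) * norm b"] by blast
  have \<phi>e: "\<phi> (e n) = (real n + 1) * norm (e n)" for n
    using \<phi>[of "e n"] e by (auto simp: inv_f_f)
  have nz: "norm (e n) > 0" for n
  proof -
    have "e n \<in> B"
      using e(2) by blast
    moreover have "0 \<notin> B"
      using dependent_zero \<open>independent B\<close> by blast
    ultimately show ?thesis
      by (metis zero_less_norm_iff)
  qed
  define x where "x n = e n /\<^sub>R \<phi> (e n)" for n
  have "x n \<in> span B" for n
    unfolding x_def using e(2) by (intro span_scale span_base) auto
  moreover have "\<phi> (x n) = 1" for n
    using nz[of n] by (simp add: x_def linear_scale[OF lin] \<phi>e del: inverse_mult_distrib)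
  moreover have "x \<longlonglongrightarrow> 0"
  proof (rule tendsto_norm_zero_cancel)
    have "norm (x n) = inverse (real (Suc n))" for n
    proof -
      have "norm (x n) = norm (e n) / ((real n + 1) * norm (e n))"
        by (simp add: x_def \<phi>e divide_inverse abs_mult)
      then show ?thesis
        using nz[of n] by (simp add: inverse_eq_divide)
    qed
    then show "(\<lambda>n. norm (x n)) \<longlonglongrightarrow> 0"
      using LIMSEQ_inverse_real_of_nat by presburger
  qed
  ultimately show ?thesis
    using that lin by blast
qed

lemma has_hamel_dim_linear_image:
  assumes "has_hamel_dim W \<alpha>" and "linear T" and "inj_on T W"
  shows "has_hamel_dim (T ` W) \<alpha>"
proof -
  obtain B where B: "independent B" "span B = W" "|B| =o \<alpha>"
    using assms(1) unfolding has_hamel_dim_def by blast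
  have "inj_on T (span B)"
    using assms(3) B(2) by simp
  then have "independent (T ` B)"
    using linear_independent_injective_image[OF assms(2) B(1)] by blast
  moreover have "span (T ` B) = T ` W"
    using linear_span_image[OF assms(2)] B(2) by blast
  moreover have "|T ` B| =o \<alpha>"
  proof -
    have "inj_on T B"
      using assms(3) B(2) span_superset inj_on_subset by blast
    then have "|B| =o |T ` B|"
      using card_of_ordIsoI inj_on_imp_bij_betw by blast
    then show ?thesis
      using B(3) ordIso_symmetric ordIso_transitive by blast
  qed
  moreover have "subspace (T ` W)"
    using subspace_span calculation(2) by metis
  ultimately show ?thesis
    unfolding has_hamel_dim_def by blast
qed

text \<open>
  The tilted space described at the beginning contains the vectors \<open>x n + u\<close>, where \<open>x\<close> is a null
  sequence in \<open>W\<close> with \<open>\<phi> (x n) = 1\<close>; their limit \<open>u\<close> lies outside \<open>A \<union> {0}\<close>.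
\<close>

lemma not_spaceable_if_translation_invariant:
  fixes A :: "'a::real_normed_vector set"
  assumes "u \<noteq> 0" and "u \<notin> A" and translate: "\<And>a t. a \<in> A \<Longrightarrow> a + t *\<^sub>R u \<in> A"
    and "natLeq \<le>o \<alpha>"
  shows "\<not> spaceable \<alpha> \<beta> A"
proof
  assume "spaceable \<alpha> \<beta> A"
  then have "lineable \<alpha> A"
    and closed_above: "\<And>W. has_hamel_dim W \<alpha> \<Longrightarrow> W \<subseteq> A \<union> {0} \<Longrightarrow>
      \<exists>V. has_hamel_dim V \<beta> \<and> closed V \<and> W \<subseteq> V \<and> V \<subseteq> A \<union> {0}"
    unfolding spaceable_def by simp_all
  then obtain W where W: "has_hamel_dim W \<alpha>" "W \<subseteq> A \<union> {0}"
    unfolding lineable_def by blast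
  then obtain B where B: "independent B" "span B = W" "|B| =o \<alpha>"
    unfolding has_hamel_dim_def by blast
  have "natLeq \<le>o |B|"
    by (rule ordLeq_ordIso_trans[OF assms(4) ordIso_symmetric[OF B(3)]])
  then have "infinite B"
    using infinite_iff_natLeq_ordLeq by blast
  then obtain \<phi> :: "'a \<Rightarrow> real" and x
    where \<phi>: "linear \<phi>" and x: "\<And>n. x n \<in> span B" "\<And>n. \<phi> (x n) = 1" "x \<longlonglongrightarrow> 0"
    by (rule infinite_independent_unbounded_functional[OF B(1)]) (rule that)
  define T where "T w = w + \<phi> w *\<^sub>R u" for w
  have T: "linear T"
    unfolding T_def
    by (rule linearI) (simp_all add: linear_add[OF \<phi>] linear_scale[OF \<phi>] algebra_simps)
  \<comment> \<open>otherwise translating \<open>0\<close> would put \<open>u\<close> into \<open>A\<close>; this is what makes the tilt injective\<close>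
  have "0 \<notin> A"
    using translate[of 0 1] \<open>u \<notin> A\<close> by auto
  have T_in: "T w \<in> A" if "w \<in> W" "w \<noteq> 0" for w
    using that W(2) translate unfolding T_def by blast
  have "subspace W"
    using B(2) subspace_span by blast
  then have "inj_on T W"
    unfolding linear_injective_on_subspace_0[OF T \<open>subspace W\<close>]
    using T_in \<open>0 \<notin> A\<close> by metis
  then have "has_hamel_dim (T ` W) \<alpha>"
    by (rule has_hamel_dim_linear_image[OF W(1) T])
  moreover have "T ` W \<subseteq> A \<union> {0}"
    using T_in linear_0[OF T] by fastforce
  ultimately have "\<exists>V. has_hamel_dim V \<beta> \<and> closed V \<and> T ` W \<subseteq> V \<and> V \<subseteq> A \<union> {0}"
    by (rule closed_above)
  then obtain V where V: "closed V" "T ` W \<subseteq> V" "V \<subseteq> A \<union> {0}"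
    by (elim exE conjE) (rule that)
  have "T (x n) \<in> V" for n
    using V(2) x(1)[of n] B(2) by auto
  moreover have "(\<lambda>n. T (x n)) \<longlonglongrightarrow> u"
    unfolding T_def x(2) using tendsto_add[OF x(3) tendsto_const[of u]] by simp
  ultimately have "u \<in> V"
    by (rule closed_sequentially[OF V(1)])
  then show False
    using V(3) \<open>u \<noteq> 0\<close> \<open>u \<notin> A\<close> by auto
qed

lemma on_reals_add_const:
  "on_reals (f + t *\<^sub>R const_bcontfun c) = (\<lambda>x. on_reals f x + t * c)"
  by (simp add: on_reals_def fun_eq_iff)

lemma ND_add_const:
  assumes "f \<in> ND"
  shows "f + t *\<^sub>R const_bcontfun c \<in> ND"
proof -
  have "on_reals f differentiable F"
    if "(\<lambda>x. on_reals f x + t * c) differentiable F" for F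
    using differentiable_diff[OF that differentiable_const[of "t * c"]] by simp
  then show ?thesis
    using assms unfolding ND_def by (auto simp: on_reals_add_const)
qed

lemma const_notin_ND: "const_bcontfun c \<notin> ND"
proof -
  have "on_reals (const_bcontfun c) = (\<lambda>_. c)"
    by (simp add: on_reals_def fun_eq_iff)
  then show ?thesis
    unfolding ND_def by (auto intro!: bexI[of _ 0])
qed

theorem corollary2p2:
  fixes \<alpha> :: "'i rel" and \<beta> :: "'j rel"
  assumes "Card_order \<alpha>" and "Card_order \<beta>"
    and "natLeq \<le>o \<alpha>" and "\<alpha> \<le>o \<beta>"
  shows "\<not> spaceable \<alpha> \<beta> ND"
proof (rule not_spaceable_if_translation_invariant)
  show "const_bcontfun 1 \<noteq> (0 :: C01)"
    by (metis const_bcontfun.rep_eq zero_bcontfun.rep_eq zero_neq_one)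
qed (use assms(3) ND_add_const const_notin_ND in auto)

end
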